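(* Let $\varphi_1\colon\mathcal{B}_1\to\mathbb{R}_+$ and $\varphi_2\colon\mathcal{B}_2\to\mathbb{R}_+$ be polymatroid functions on set algebras $(J_1,\mathcal{B}_1)$ and $(J_2,\mathcal{B}_2)$. Then there exists a polymatroid function $\varphi$ on the product algebra $(J_1\times J_2,\mathcal{B}_1\otimes\mathcal{B}_2)$ which is a coupling of $\varphi_1$ and $\varphi_2$.
   Context: A set algebra $(J,\mathcal{B})$ is a family $\mathcal{B}$ of subsets of $J$ containing $\emptyset$ and closed under complements and finite unions; $\mathcal{B}_1\otimes\mathcal{B}_2$ is the algebra on $J_1\times J_2$ generated by the sets $X_1\times J_2$ ($X_1\in\mathcal{B}_1$) and $J_1\times X_2$ ($X_2\in\mathcal{B}_2$). A polymatroid function on $(J,\mathcal{B})$ is $\varphi\colon\mathcal{B}\to\mathbb{R}_+$ that is increasing, submodular ($\varphi(X)+\varphi(Y)\ge\varphi(X\cap Y)+\varphi(X\cup Y)$) and has $\varphi(\emptyset)=0$. $\varphi$ is a coupling of $\varphi_1,\varphi_2$ if $\varphi(X_1\times J_2)=\varphi_1(X_1)\varphi_2(J_2)$ for all $X_1\in\mathcal{B}_1$ and $\varphi(J_1\times X_2)=\varphi_1(J_1)\varphi_2(X_2)$ for all $X_2\in\mathcal{B}_2$. *)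

theory Defs
  imports "HOL-Analysis.Analysis"
begin

definition product_algebra ::
    "'a set \<Rightarrow> 'a set set \<Rightarrow> 'b set \<Rightarrow> 'b set set \<Rightarrow> ('a \<times> 'b) set set" where
  "product_algebra J1 B1 J2 B2 =
     algebra (J1 \<times> J2) hull ({X1 \<times> J2 |X1. X1 \<in> B1} \<union> {J1 \<times> X2 |X2. X2 \<in> B2})"

text \<open>The hull is an intersection of algebras. The next lemma makes sure that it is not the empty
  intersection, so that the generated family is itself an algebra.\<close>

lemma algebra_product_algebra:
  assumes "algebra J1 B1" and "algebra J2 B2"
  shows "algebra (J1 \<times> J2) (product_algebra J1 B1 J2 B2)"
proof -
  let ?G = "{X1 \<times> J2 |X1. X1 \<in> B1} \<union> {J1 \<times> X2 |X2. X2 \<in> B2}"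
  have "B1 \<subseteq> Pow J1" and "B2 \<subseteq> Pow J2"
    using assms by (auto simp: algebra_iff_Un)
  then have "?G \<subseteq> Pow (J1 \<times> J2)"
    by blast
  then have "product_algebra J1 B1 J2 B2 \<subseteq> Pow (J1 \<times> J2)"
    unfolding product_algebra_def by (intro hull_minimal algebra_Pow)
  then show ?thesis
    unfolding product_algebra_def hull_def by (auto simp: algebra_iff_Un)
qed

text \<open>Set functions are total in HOL. Only the values of \<open>\<phi>\<close> on members of \<open>B\<close> are constrained.\<close>

locale polymatroid_function = algebra J B
  for J :: "'a set" and B :: "'a set set" +
  fixes \<phi> :: "'a set \<Rightarrow> real"
  assumes nonneg: "X \<in> B \<Longrightarrow> 0 \<le> \<phi> X"
    and increasing: "X \<in> B \<Longrightarrow> Y \<in> B \<Longrightarrow> X \<subseteq> Y \<Longrightarrow> \<phi> X \<le> \<phi> Y"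
    and submodular: "X \<in> B \<Longrightarrow> Y \<in> B \<Longrightarrow> \<phi> (X \<inter> Y) + \<phi> (X \<union> Y) \<le> \<phi> X + \<phi> Y"
    and empty: "\<phi> {} = 0"

definition is_coupling ::
    "'a set \<Rightarrow> 'a set set \<Rightarrow> ('a set \<Rightarrow> real) \<Rightarrow> 'b set \<Rightarrow> 'b set set \<Rightarrow> ('b set \<Rightarrow> real)
      \<Rightarrow> (('a \<times> 'b) set \<Rightarrow> real) \<Rightarrow> bool" where
  "is_coupling J1 B1 \<phi>1 J2 B2 \<phi>2 \<phi> \<longleftrightarrow>
     (\<forall>X1\<in>B1. \<phi> (X1 \<times> J2) = \<phi>1 X1 * \<phi>2 J2) \<and>
     (\<forall>X2\<in>B2. \<phi> (J1 \<times> X2) = \<phi>1 J1 * \<phi>2 X2)"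

end

theory Submission
  imports Defs
begin

text \<open>Every polymatroid function \<open>\<phi>\<close> dominates a finitely additive \<open>\<mu>\<close> with the same total mass.
  With such \<open>\<mu>\<^sub>1 \<le> \<phi>\<^sub>1\<close> and \<open>\<mu>\<^sub>2 \<le> \<phi>\<^sub>2\<close>, put
  \<open>\<psi>(X) = \<integral> \<phi>\<^sub>1(X\<^sup>y) d\<mu>\<^sub>2(y) + \<integral> \<phi>\<^sub>2(X\<^sub>x) d\<mu>\<^sub>1(x) - (\<mu>\<^sub>1 \<times> \<mu>\<^sub>2)(X)\<close>. This is submodular and has the
  right marginals, but it need not be increasing. Its increasing envelope
  \<open>\<phi>(X) = inf {\<psi>(Y) | X \<subseteq> Y}\<close> is a polymatroid function, and it keeps the marginals: if
  \<open>X\<^sub>1 \<times> J\<^sub>2 \<subseteq> Y\<close>, then the first integral is at least \<open>\<phi>\<^sub>1(X\<^sub>1) \<phi>\<^sub>2(J\<^sub>2)\<close>, and the rest is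
  \<open>\<integral> (\<phi>\<^sub>2 - \<mu>\<^sub>2)(Y\<^sub>x) d\<mu>\<^sub>1(x) \<ge> 0\<close>.\<close>

section \<open>Additive minorants\<close>

text \<open>Finitely additive nonnegative set functions, kept inside the polymatroid functions so
  that a minimal polymatroid function only has to be shown additive.\<close>

locale additive_polymatroid = polymatroid_function +
  assumes additive: "X \<in> B \<Longrightarrow> Y \<in> B \<Longrightarrow> X \<inter> Y = {} \<Longrightarrow> \<phi> (X \<union> Y) = \<phi> X + \<phi> Y"
begin

declare empty [simp]

text \<open>\<open>Y - X\<close> is cut off both \<open>X \<union> Y\<close> and \<open>Y\<close>.
  Having equality here lets an additive function be subtracted from a submodular one without losing
  submodularity.\<close>

lemma modular:
  assumes "X \<in> B" "Y \<in> B"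
  shows "\<phi> (X \<inter> Y) + \<phi> (X \<union> Y) = \<phi> X + \<phi> Y"
proof -
  have "\<phi> (X \<union> (Y - X)) = \<phi> X + \<phi> (Y - X)"
    using assms by (intro additive) auto
  moreover have "\<phi> ((X \<inter> Y) \<union> (Y - X)) = \<phi> (X \<inter> Y) + \<phi> (Y - X)"
    using assms by (intro additive) auto
  moreover have "X \<union> (Y - X) = X \<union> Y" "(X \<inter> Y) \<union> (Y - X) = Y"
    by auto
  ultimately show ?thesis by simp
qed

lemma finite_additive:
  assumes "finite I" "\<And>i. i \<in> I \<Longrightarrow> A i \<in> B" "disjoint_family_on A I"
  shows "\<phi> (\<Union>i\<in>I. A i) = (\<Sum>i\<in>I. \<phi> (A i))"
  using assms
proof (induction I)
  case empty
  then show ?case by simp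
next
  case (insert i I)
  have "\<phi> (A i \<union> (\<Union>i\<in>I. A i)) = \<phi> (A i) + \<phi> (\<Union>i\<in>I. A i)"
    using insert.prems insert.hyps
    by (intro additive finite_UN) (auto simp: disjoint_family_on_def)
  moreover have "disjoint_family_on A I"
    using insert.prems(2) by (auto simp: disjoint_family_on_def)
  ultimately show ?case
    using insert by simp
qed

end

text \<open>For \<open>A \<in> B\<close> this is the direct sum of the restriction of \<open>\<phi>\<close> to \<open>A\<close> and its contraction
  by \<open>A\<close>.\<close>

lemma (in polymatroid_function) polymatroid_restrict_contract:
  assumes A: "A \<in> B"
  shows "polymatroid_function J B (\<lambda>X. \<phi> (X \<inter> A) + \<phi> (X \<union> A) - \<phi> A)"
proof unfold_locales
  fix X assume X: "X \<in> B"
  then have "\<phi> A \<le> \<phi> (X \<union> A)" "0 \<le> \<phi> (X \<inter> A)"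
    using A by (auto intro: increasing nonneg)
  then show "0 \<le> \<phi> (X \<inter> A) + \<phi> (X \<union> A) - \<phi> A" by simp
  fix Y assume Y: "Y \<in> B"
  have "\<phi> ((X \<inter> A) \<inter> (Y \<inter> A)) + \<phi> ((X \<inter> A) \<union> (Y \<inter> A)) \<le> \<phi> (X \<inter> A) + \<phi> (Y \<inter> A)"
    "\<phi> ((X \<union> A) \<inter> (Y \<union> A)) + \<phi> ((X \<union> A) \<union> (Y \<union> A)) \<le> \<phi> (X \<union> A) + \<phi> (Y \<union> A)"
    using X Y A by (intro submodular; blast)+
  moreover have "(X \<inter> A) \<inter> (Y \<inter> A) = X \<inter> Y \<inter> A" "(X \<inter> A) \<union> (Y \<inter> A) = (X \<union> Y) \<inter> A"
    "(X \<union> A) \<inter> (Y \<union> A) = X \<inter> Y \<union> A" "(X \<union> A) \<union> (Y \<union> A) = X \<union> Y \<union> A"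
    by auto
  ultimately show "\<phi> (X \<inter> Y \<inter> A) + \<phi> (X \<inter> Y \<union> A) - \<phi> A +
      (\<phi> ((X \<union> Y) \<inter> A) + \<phi> (X \<union> Y \<union> A) - \<phi> A)
    \<le> \<phi> (X \<inter> A) + \<phi> (X \<union> A) - \<phi> A + (\<phi> (Y \<inter> A) + \<phi> (Y \<union> A) - \<phi> A)"
    by simp
  assume "X \<subseteq> Y"
  then have "\<phi> (X \<inter> A) \<le> \<phi> (Y \<inter> A)" "\<phi> (X \<union> A) \<le> \<phi> (Y \<union> A)"
    using X Y A by (intro increasing; blast)+
  then show "\<phi> (X \<inter> A) + \<phi> (X \<union> A) - \<phi> A \<le> \<phi> (Y \<inter> A) + \<phi> (Y \<union> A) - \<phi> A" by simp
qed (simp add: empty)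

text \<open>Submodularity does not survive arbitrary pointwise infima. In a chain, though, the
  infima at \<open>X\<close> and at \<open>Y\<close> can be approached by one common member.\<close>

lemma polymatroid_INF_chain:
  assumes ne: "C \<noteq> {}" and poly: "\<And>\<psi>. \<psi> \<in> C \<Longrightarrow> polymatroid_function J B \<psi>"
    and chain: "\<And>\<psi> \<psi>'. \<psi> \<in> C \<Longrightarrow> \<psi>' \<in> C \<Longrightarrow> \<psi> \<le> \<psi>' \<or> \<psi>' \<le> \<psi>"
  shows "polymatroid_function J B (\<lambda>X. INF \<psi>\<in>C. \<psi> X)"
proof -
  obtain \<psi>\<^sub>0 where "\<psi>\<^sub>0 \<in> C" using ne by blast
  then interpret polymatroid_function J B \<psi>\<^sub>0 by (rule poly)
  have bdd: "bdd_below ((\<lambda>\<psi>. \<psi> X) ` C)" if "X \<in> B" for X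
    using polymatroid_function.nonneg[OF poly that] by (rule bdd_belowI2)
  have le: "(INF \<psi>\<in>C. \<psi> X) \<le> \<psi> X" if "X \<in> B" "\<psi> \<in> C" for X \<psi>
    using bdd that by (intro cINF_lower)
  show ?thesis
  proof unfold_locales
    fix X assume X: "X \<in> B"
    then show "0 \<le> (INF \<psi>\<in>C. \<psi> X)"
      using polymatroid_function.nonneg[OF poly] by (intro cINF_greatest[OF ne])
    fix Y assume Y: "Y \<in> B"
    { assume "X \<subseteq> Y"
      then have "(INF \<psi>\<in>C. \<psi> X) \<le> \<psi> Y" if "\<psi> \<in> C" for \<psi>
        using le[OF X that] polymatroid_function.increasing[OF poly[OF that] X Y] by simp
      then show "(INF \<psi>\<in>C. \<psi> X) \<le> (INF \<psi>\<in>C. \<psi> Y)"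
        by (rule cINF_greatest[OF ne]) }
    let ?L = "(INF \<psi>\<in>C. \<psi> (X \<inter> Y)) + (INF \<psi>\<in>C. \<psi> (X \<union> Y))"
    have "X \<inter> Y \<in> B" "X \<union> Y \<in> B" using X Y by auto
    then have *: "?L \<le> \<psi> X + \<psi> Y" if "\<psi> \<in> C" for \<psi>
      using le[of "X \<inter> Y" \<psi>] le[of "X \<union> Y" \<psi>] that
        polymatroid_function.submodular[OF poly[OF that] X Y] by simp
    \<comment> \<open>The smaller of \<open>\<psi>\<close> and \<open>\<psi>'\<close> serves both
      sets at once; afterwards the two infima can be taken independently.\<close>
    have **: "?L \<le> \<psi> X + \<psi>' Y" if "\<psi> \<in> C" "\<psi>' \<in> C" for \<psi> \<psi>'
      using chain[OF that] *[OF that(1)] *[OF that(2)]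
      by (metis (no_types) add_left_mono add_right_mono le_fun_def order_trans)
    have "?L - \<psi> X \<le> (INF \<psi>\<in>C. \<psi> Y)" if "\<psi> \<in> C" for \<psi>
      using **[OF that] by (intro cINF_greatest[OF ne]) (simp add: algebra_simps)
    then have "?L - (INF \<psi>\<in>C. \<psi> Y) \<le> (INF \<psi>\<in>C. \<psi> X)"
      by (intro cINF_greatest[OF ne]) (simp add: algebra_simps)
    then show "?L \<le> (INF \<psi>\<in>C. \<psi> X) + (INF \<psi>\<in>C. \<psi> Y)" by simp
  next
    have "(INF \<psi>\<in>C. \<psi> {}) = (INF \<psi>\<in>C. 0)"
      using polymatroid_function.empty[OF poly] by (intro INF_cong) simp_all
    then show "(INF \<psi>\<in>C. \<psi> {}) = 0" using ne by simp
  qed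
qed

text \<open>A minimal polymatroid function with the given total mass coincides, for each \<open>A\<close>, with its
  restriction-contraction at \<open>A\<close>, and is therefore additive.\<close>

lemma (in polymatroid_function) additive_minorant:
  obtains \<mu> where "additive_polymatroid J B \<mu>" "\<mu> J = \<phi> J" "\<And>X. X \<in> B \<Longrightarrow> \<mu> X \<le> \<phi> X"
proof -
  \<comment> \<open>The value 0 outside \<open>B\<close> keeps infima of chains bounded below at
    every argument, and makes the order on total functions depend on the values on \<open>B\<close>
    alone.\<close>
  define M where "M = {\<psi>. polymatroid_function J B \<psi> \<and> \<psi> J = \<phi> J \<and> (\<forall>X\<in>B. \<psi> X \<le> \<phi> X) \<and>
    (\<forall>X. X \<notin> B \<longrightarrow> \<psi> X = 0)}"
  \<comment> \<open>The order is reversed, so that Zorn's lemma delivers a minimal element.\<close>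
  let ?r = "relation_of (\<lambda>\<psi> \<psi>'. \<psi>' \<le> \<psi>) M"
  define \<phi>' where "\<phi>' = (\<lambda>X. if X \<in> B then \<phi> X else 0)"
  have "polymatroid_function J B \<phi>'"
    by unfold_locales (auto simp: \<phi>'_def nonneg increasing submodular empty)
  then have \<phi>': "\<phi>' \<in> M"
    by (auto simp: M_def \<phi>'_def)
  have "\<exists>m\<in>M. \<forall>\<psi>\<in>M. \<psi> \<le> m \<longrightarrow> \<psi> = m"
  proof (rule predicate_Zorn)
    show "partial_order_on M ?r"
      by (rule partial_order_on_relation_ofI) auto
    fix C assume C: "C \<in> Chains ?r"
    then have CM: "C \<subseteq> M" by (rule Chains_relation_of)
    show "\<exists>u\<in>M. \<forall>\<psi>\<in>C. u \<le> \<psi>"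
    proof (cases "C = {}")
      case True
      then show ?thesis using \<phi>' by blast
    next
      case ne: False
      let ?u = "\<lambda>X. INF \<psi>\<in>C. \<psi> X"
      have poly: "polymatroid_function J B \<psi>" if "\<psi> \<in> C" for \<psi>
        using that CM by (auto simp: M_def)
      have bdd: "bdd_below ((\<lambda>\<psi>. \<psi> X) ` C)" for X
      proof (rule bdd_belowI2)
        show "0 \<le> \<psi> X" if "\<psi> \<in> C" for \<psi>
          using that CM polymatroid_function.nonneg[OF poly[OF that], of X]
          by (cases "X \<in> B") (auto simp: M_def)
      qed
      have le: "?u X \<le> \<psi> X" if "\<psi> \<in> C" for \<psi> X
        using bdd that by (rule cINF_lower)
      have "polymatroid_function J B ?u"
        using C by (intro polymatroid_INF_chain ne poly) (auto simp: Chains_def relation_of_def)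
      moreover have "?u J = \<phi> J"
      proof -
        have "?u J = (INF \<psi>\<in>C. \<phi> J)" using CM by (intro INF_cong) (auto simp: M_def)
        then show ?thesis using ne by simp
      qed
      moreover have "?u X \<le> \<phi> X" if "X \<in> B" for X
      proof -
        obtain \<psi> where "\<psi> \<in> C" using ne by blast
        then have "\<psi> X \<le> \<phi> X" using CM that by (auto simp: M_def)
        then show ?thesis using le[OF \<open>\<psi> \<in> C\<close>, of X] by simp
      qed
      moreover have "?u X = 0" if "X \<notin> B" for X
      proof -
        have "?u X = (INF \<psi>\<in>C. 0)" using CM that by (intro INF_cong) (auto simp: M_def)
        then show ?thesis using ne by simp
      qed
      ultimately have "?u \<in> M" by (auto simp: M_def)
      then show ?thesis using le by (intro bexI[of _ ?u]) (auto simp: le_fun_def)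
    qed
  qed
  then obtain \<mu> where \<mu>: "\<mu> \<in> M" and min: "\<And>\<psi>. \<psi> \<in> M \<Longrightarrow> \<psi> \<le> \<mu> \<Longrightarrow> \<psi> = \<mu>" by blast
  interpret \<mu>: polymatroid_function J B \<mu> using \<mu> by (simp add: M_def)
  have eq: "\<mu> (X \<inter> A) + \<mu> (X \<union> A) - \<mu> A = \<mu> X" if A: "A \<in> B" and X: "X \<in> B" for A X
  proof -
    interpret D: polymatroid_function J B "\<lambda>X. \<mu> (X \<inter> A) + \<mu> (X \<union> A) - \<mu> A"
      using A by (rule \<mu>.polymatroid_restrict_contract)
    let ?\<psi> = "\<lambda>X. if X \<in> B then \<mu> (X \<inter> A) + \<mu> (X \<union> A) - \<mu> A else 0"
    have "polymatroid_function J B ?\<psi>"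
    proof unfold_locales
      fix X Y assume "X \<in> B" "Y \<in> B"
      moreover from this have "X \<inter> Y \<in> B" "X \<union> Y \<in> B" by auto
      ultimately show "?\<psi> (X \<inter> Y) + ?\<psi> (X \<union> Y) \<le> ?\<psi> X + ?\<psi> Y"
        using D.submodular[of X Y] by simp
    qed (use D.nonneg D.increasing D.empty in auto)
    moreover have "?\<psi> J = \<phi> J"
    proof -
      have "J \<inter> A = A" "J \<union> A = J" using A sets_into_space by auto
      then show ?thesis using \<mu> by (simp add: M_def)
    qed
    \<comment> \<open>On \<open>B\<close> this is submodularity of \<open>\<mu>\<close> at
      \<open>X\<close> and \<open>A\<close>; outside \<open>B\<close> both sides are 0.\<close>
    moreover have le: "?\<psi> X \<le> \<mu> X" for X
      using \<mu>.submodular[of X A] A \<mu> by (auto simp: M_def)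
    moreover have "?\<psi> X \<le> \<phi> X" if "X \<in> B" for X
      using le[of X] \<mu> that by (auto simp: M_def intro: order_trans)
    ultimately have "?\<psi> \<in> M" by (auto simp: M_def)
    then have "?\<psi> = \<mu>" using le by (intro min) (auto simp: le_fun_def)
    then have "?\<psi> X = \<mu> X" by (rule fun_cong)
    then show ?thesis using X by simp
  qed
  have "additive_polymatroid J B \<mu>"
  proof unfold_locales
    fix X Y assume "X \<in> B" "Y \<in> B" "X \<inter> Y = {}"
    \<comment> \<open>For disjoint sets the restriction term is \<open>\<mu> {} = 0\<close>, and the
      identity \<open>eq\<close> becomes additivity.\<close>
    then show "\<mu> (X \<union> Y) = \<mu> X + \<mu> Y"
      using eq[of Y X] by (simp add: \<mu>.empty)
  qed
  then show thesis using that \<mu> by (auto simp: M_def)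
qed

section \<open>Integration of simple functions\<close>

text \<open>The codomain is arbitrary because truth values, pairs and, above all, sections of a set
  occur as values, not only reals.\<close>

definition simple_map :: "'a set \<Rightarrow> 'a set set \<Rightarrow> ('a \<Rightarrow> 'c) \<Rightarrow> bool" where
  "simple_map J B g \<longleftrightarrow> finite (g ` J) \<and> (\<forall>c. {x \<in> J. g x = c} \<in> B)"

text \<open>With only finite additivity at hand, the integral is a finite sum over level sets,
  without limits. An infinite range gives the default value 0.\<close>

definition simple_integral_on :: "'a set \<Rightarrow> ('a set \<Rightarrow> real) \<Rightarrow> ('a \<Rightarrow> real) \<Rightarrow> real" where
  "simple_integral_on J \<mu> f = (\<Sum>v\<in>f ` J. v * \<mu> {x \<in> J. f x = v})"

lemma simple_map_cong:
  assumes "\<And>x. x \<in> J \<Longrightarrow> f x = g x"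
  shows "simple_map J B f \<longleftrightarrow> simple_map J B g"
proof -
  have "f ` J = g ` J" "{x \<in> J. f x = c} = {x \<in> J. g x = c}" for c
    using assms by auto
  then show ?thesis by (simp add: simple_map_def)
qed

lemma simple_integral_on_cong:
  assumes "\<And>x. x \<in> J \<Longrightarrow> f x = g x"
  shows "simple_integral_on J \<mu> f = simple_integral_on J \<mu> g"
proof -
  have "f ` J = g ` J" "{x \<in> J. f x = c} = {x \<in> J. g x = c}" for c
    using assms by auto
  then show ?thesis by (simp add: simple_integral_on_def)
qed

section \<open>Closure properties of simple maps\<close>

context algebra
begin

lemma simple_map_compose:
  assumes "simple_map \<Omega> M g"
  shows "simple_map \<Omega> M (\<lambda>x. h (g x))"
proof -
  have "{x \<in> \<Omega>. h (g x) = c} = (\<Union>d\<in>{d \<in> g ` \<Omega>. h d = c}. {x \<in> \<Omega>. g x = d})" for c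
    by auto
  moreover have "finite ((\<lambda>x. h (g x)) ` \<Omega>)"
    using assms finite_imageI[of "g ` \<Omega>" h] by (simp add: simple_map_def image_image)
  ultimately show ?thesis
    using assms unfolding simple_map_def by (auto intro!: finite_UN)
qed

text \<open>The fibres of the pair are intersections of fibres: the common refinement of two finite
  partitions, through which every binary operation factors.\<close>

lemma simple_map_Pair:
  assumes "simple_map \<Omega> M f" "simple_map \<Omega> M g"
  shows "simple_map \<Omega> M (\<lambda>x. (f x, g x))"
proof -
  have "finite ((\<lambda>x. (f x, g x)) ` \<Omega>)"
  proof (rule finite_subset)
    show "(\<lambda>x. (f x, g x)) ` \<Omega> \<subseteq> f ` \<Omega> \<times> g ` \<Omega>" by blast
    show "finite (f ` \<Omega> \<times> g ` \<Omega>)" using assms by (simp add: simple_map_def)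
  qed
  moreover have "{x \<in> \<Omega>. (f x, g x) = c} \<in> M" for c
  proof -
    have "{x \<in> \<Omega>. (f x, g x) = c} = {x \<in> \<Omega>. f x = fst c} \<inter> {x \<in> \<Omega>. g x = snd c}"
      by auto
    moreover have "{x \<in> \<Omega>. f x = fst c} \<in> M" "{x \<in> \<Omega>. g x = snd c} \<in> M"
      using assms by (simp_all add: simple_map_def)
    ultimately show ?thesis by (simp only: Int)
  qed
  ultimately show ?thesis
    by (simp add: simple_map_def)
qed

lemma simple_map_compose2:
  assumes "simple_map \<Omega> M f" "simple_map \<Omega> M g"
  shows "simple_map \<Omega> M (\<lambda>x. h (f x) (g x))"
  using simple_map_compose[OF simple_map_Pair[OF assms], of "case_prod h"]
  by (simp only: prod.case)

lemma simple_map_const: "simple_map \<Omega> M (\<lambda>_. c)"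
proof -
  have "{x \<in> \<Omega>. c = d} = (if c = d then \<Omega> else {})" for d
    by auto
  then show ?thesis by (simp add: simple_map_def image_constant_conv)
qed

lemma simple_map_If:
  assumes "A \<in> M"
  shows "simple_map \<Omega> M (\<lambda>x. if x \<in> A then c else d)"
proof -
  have "{x \<in> \<Omega>. (x \<in> A) = b} = (if b then A else \<Omega> - A)" for b
    using assms sets_into_space by auto
  then have "simple_map \<Omega> M (\<lambda>x. x \<in> A)"
    using assms unfolding simple_map_def by auto
  then show ?thesis by (rule simple_map_compose)
qed

lemma simple_map_sum:
  assumes "\<And>i. i \<in> I \<Longrightarrow> simple_map \<Omega> M (f i)"
  shows "simple_map \<Omega> M (\<lambda>x. \<Sum>i\<in>I. f i x)"
  using assms by (induction I rule: infinite_finite_induct)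
    (auto intro: simple_map_const simple_map_compose2)

end

section \<open>Linearity and monotonicity of the integral\<close>

context additive_polymatroid
begin

text \<open>The integral may be computed on a partition finer than the level sets, since each level
  set of the composite is a finite disjoint union of fibres of \<open>g\<close>.\<close>

lemma simple_integral_on_compose:
  assumes g: "simple_map J B g"
  shows "simple_integral_on J \<phi> (\<lambda>x. h (g x)) = (\<Sum>c\<in>g ` J. h c * \<phi> {x \<in> J. g x = c})"
proof -
  have fin: "finite (g ` J)" and fib: "{x \<in> J. g x = c} \<in> B" for c
    using g by (auto simp: simple_map_def)
  have *: "\<phi> {x \<in> J. h (g x) = v} = (\<Sum>c | c \<in> g ` J \<and> h c = v. \<phi> {x \<in> J. g x = c})" for v
  proof -
    have "{x \<in> J. h (g x) = v} = (\<Union>c\<in>{c. c \<in> g ` J \<and> h c = v}. {x \<in> J. g x = c})"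
      by auto
    then show ?thesis
      using fin fib by (simp only:) (intro finite_additive; auto simp: disjoint_family_on_def)
  qed
  have "simple_integral_on J \<phi> (\<lambda>x. h (g x)) =
      (\<Sum>v\<in>h ` g ` J. \<Sum>c | c \<in> g ` J \<and> h c = v. h c * \<phi> {x \<in> J. g x = c})"
    unfolding simple_integral_on_def image_image *
    by (intro sum.cong refl) (simp add: sum_distrib_left)
  also have "\<dots> = (\<Sum>c\<in>g ` J. h c * \<phi> {x \<in> J. g x = c})"
    using fin by (rule sum.image_gen[symmetric])
  finally show ?thesis .
qed

text \<open>\<open>f\<close>, \<open>g\<close> and \<open>f + g\<close> have different level sets,
  so all three integrals are computed on the fibres of the pair map, where the claim is linearity of
  a finite sum.\<close>

lemma simple_integral_on_add:
  assumes "simple_map J B f" "simple_map J B g"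
  shows "simple_integral_on J \<phi> (\<lambda>x. f x + g x) = simple_integral_on J \<phi> f + simple_integral_on J \<phi> g"
proof -
  let ?S = "\<lambda>h. \<Sum>c\<in>(\<lambda>x. (f x, g x)) ` J. h c * \<phi> {x \<in> J. (f x, g x) = c}"
  have *: "simple_integral_on J \<phi> (\<lambda>x. h (f x, g x)) = ?S h" for h
    using simple_map_Pair[OF assms] by (rule simple_integral_on_compose)
  have "?S (\<lambda>c. fst c + snd c) = ?S fst + ?S snd"
    by (simp only: sum.distrib distrib_right)
  then show ?thesis
    by (simp only: *[symmetric] fst_conv snd_conv)
qed

lemma simple_integral_on_mono:
  assumes "simple_map J B f" "simple_map J B g" "\<And>x. x \<in> J \<Longrightarrow> f x \<le> g x"
  shows "simple_integral_on J \<phi> f \<le> simple_integral_on J \<phi> g"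
proof -
  note fg = simple_map_Pair[OF assms(1,2)]
  have "(\<Sum>c\<in>(\<lambda>x. (f x, g x)) ` J. fst c * \<phi> {x \<in> J. (f x, g x) = c})
      \<le> (\<Sum>c\<in>(\<lambda>x. (f x, g x)) ` J. snd c * \<phi> {x \<in> J. (f x, g x) = c})"
    using fg assms(3) by (intro sum_mono mult_right_mono nonneg) (auto simp: simple_map_def)
  then show ?thesis
    using simple_integral_on_compose[OF fg, of fst] simple_integral_on_compose[OF fg, of snd]
    by simp
qed

lemma simple_integral_on_If:
  assumes "A \<in> B"
  shows "simple_integral_on J \<phi> (\<lambda>x. if x \<in> A then c else 0) = c * \<phi> A"
proof -
  have A: "A \<subseteq> J" using assms sets_into_space by auto
  have "simple_map J B (\<lambda>x. x \<in> A)"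
    using simple_map_If[OF assms, of True False] by (simp add: if_bool_eq_conj)
  then have "simple_integral_on J \<phi> (\<lambda>x. if x \<in> A then c else 0) =
      (\<Sum>b\<in>(\<lambda>x. x \<in> A) ` J. (if b then c else 0) * \<phi> {x \<in> J. (x \<in> A) = b})"
    by (rule simple_integral_on_compose)
  \<comment> \<open>If \<open>A\<close> is empty or all of \<open>J\<close>, a truth value may not
    be attained; its fibre is then empty and contributes 0.\<close>
  also have "\<dots> = (\<Sum>b\<in>{True, False}. (if b then c else 0) * \<phi> {x \<in> J. (x \<in> A) = b})"
  proof (intro sum.mono_neutral_left ballI)
    fix b assume "b \<in> {True, False} - (\<lambda>x. x \<in> A) ` J"
    then have "{x \<in> J. (x \<in> A) = b} = {}" by auto
    then show "(if b then c else 0) * \<phi> {x \<in> J. (x \<in> A) = b} = 0"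
      by (simp only: empty mult_zero_right)
  qed auto
  also have "\<dots> = c * \<phi> {x \<in> J. x \<in> A}" by simp
  also have "{x \<in> J. x \<in> A} = A" using A by auto
  finally show ?thesis .
qed

lemma simple_integral_on_zero: "simple_integral_on J \<phi> (\<lambda>_. 0) = 0"
  unfolding simple_integral_on_def by (intro sum.neutral) auto

lemma simple_integral_on_const: "simple_integral_on J \<phi> (\<lambda>_. c) = c * \<phi> J"
proof -
  have "simple_integral_on J \<phi> (\<lambda>_. c) = simple_integral_on J \<phi> (\<lambda>x. if x \<in> J then c else 0)"
    by (intro simple_integral_on_cong) simp
  also have "\<dots> = c * \<phi> J"
    by (intro simple_integral_on_If) simp
  finally show ?thesis .
qed

lemma simple_integral_on_sum:
  assumes "\<And>i. i \<in> I \<Longrightarrow> simple_map J B (f i)"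
  shows "simple_integral_on J \<phi> (\<lambda>x. \<Sum>i\<in>I. f i x) = (\<Sum>i\<in>I. simple_integral_on J \<phi> (f i))"
  using assms
proof (induction I rule: infinite_finite_induct)
  case (insert i I)
  then show ?case
    by (simp add: simple_integral_on_add simple_map_sum)
qed (simp_all add: simple_integral_on_zero)

end

section \<open>Sections of sets in the product algebra\<close>

text \<open>Stands in for measurability: it makes any real function of the section integrable over
  \<open>J1\<close>. Sections in the other direction are treated through the converse
  relation.\<close>

definition simple_sections :: "'a set \<Rightarrow> 'a set set \<Rightarrow> 'b set set \<Rightarrow> ('a \<times> 'b) set \<Rightarrow> bool" where
  "simple_sections J1 B1 B2 X \<longleftrightarrow>
     simple_map J1 B1 (\<lambda>x. X `` {x}) \<and> (\<forall>x\<in>J1. X `` {x} \<in> B2)"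

lemma simple_sections_Un:
  assumes "algebra J1 B1" "algebra J2 B2"
    and "simple_sections J1 B1 B2 X" "simple_sections J1 B1 B2 Y"
  shows "simple_sections J1 B1 B2 (X \<union> Y)"
proof -
  interpret B1: algebra J1 B1 by fact
  interpret B2: algebra J2 B2 by fact
  show ?thesis
    using assms(3,4) B1.simple_map_compose2[of "\<lambda>x. X `` {x}" "\<lambda>x. Y `` {x}" "(\<union>)"]
    by (auto simp: simple_sections_def Un_Image)
qed

lemma simple_sections_Diff:
  assumes "algebra J1 B1" "algebra J2 B2" and "simple_sections J1 B1 B2 X"
  shows "simple_sections J1 B1 B2 (J1 \<times> J2 - X)"
proof -
  interpret B1: algebra J1 B1 by fact
  interpret B2: algebra J2 B2 by fact
  have "(J1 \<times> J2 - X) `` {x} = J2 - X `` {x}" if "x \<in> J1" for x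
    using that by auto
  then show ?thesis
    using assms(3) B1.simple_map_compose[of "\<lambda>x. X `` {x}" "\<lambda>S. J2 - S"]
    by (auto simp: simple_sections_def cong: simple_map_cong)
qed

lemma simple_sections_Times:
  assumes "algebra J1 B1" "algebra J2 B2" and "X1 \<in> B1" "X2 \<in> B2"
  shows "simple_sections J1 B1 B2 (X1 \<times> X2)"
proof -
  interpret B1: algebra J1 B1 by fact
  interpret B2: algebra J2 B2 by fact
  have "(X1 \<times> X2) `` {x} = (if x \<in> X1 then X2 else {})" for x
    by auto
  then show ?thesis
    using assms(3,4) B1.simple_map_If[of X1 X2 "{}"] by (simp add: simple_sections_def)
qed

text \<open>The sets with simple sections in both directions form an algebra containing the
  generating cylinders, hence contain the generated algebra.\<close>

lemma product_algebra_simple_sections: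
  assumes alg: "algebra J1 B1" "algebra J2 B2" and X: "X \<in> product_algebra J1 B1 J2 B2"
  shows "simple_sections J1 B1 B2 X" and "simple_sections J2 B2 B1 (X\<inverse>)"
proof -
  interpret B1: algebra J1 B1 by fact
  interpret B2: algebra J2 B2 by fact
  define T where
    "T = {X. X \<subseteq> J1 \<times> J2 \<and> simple_sections J1 B1 B2 X \<and> simple_sections J2 B2 B1 (X\<inverse>)}"
  \<comment> \<open>Rectangles cover both kinds of generators, and the empty rectangle supplies
    \<open>{}\<close>.\<close>
  have Times: "X1 \<times> X2 \<in> T" if "X1 \<in> B1" "X2 \<in> B2" for X1 X2
  proof -
    have "X1 \<times> X2 \<subseteq> J1 \<times> J2"
      using that B1.sets_into_space B2.sets_into_space by blast
    then show ?thesis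
      using that simple_sections_Times[OF alg] simple_sections_Times[OF alg(2,1)]
      by (simp add: T_def converse_Times)
  qed
  have "algebra (J1 \<times> J2) T"
    unfolding algebra_iff_Un
  proof (intro conjI ballI)
    show "{} \<in> T" using Times[of "{}" "{}"] by simp
  next
    fix X assume X: "X \<in> T"
    have "(J1 \<times> J2 - X)\<inverse> = J2 \<times> J1 - X\<inverse>" by auto
    then show "J1 \<times> J2 - X \<in> T"
      using X simple_sections_Diff[OF alg] simple_sections_Diff[OF alg(2,1)] by (auto simp: T_def)
    fix Y assume "Y \<in> T"
    then show "X \<union> Y \<in> T"
      using X simple_sections_Un[OF alg] simple_sections_Un[OF alg(2,1)]
      by (auto simp: T_def converse_Un)
  qed (auto simp: T_def)
  then have "product_algebra J1 B1 J2 B2 \<subseteq> T"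
    unfolding product_algebra_def using Times by (intro hull_minimal) auto
  then show "simple_sections J1 B1 B2 X" "simple_sections J2 B2 B1 (X\<inverse>)"
    using X by (auto simp: T_def)
qed

section \<open>Integrals of functions of sections\<close>

context additive_polymatroid
begin

text \<open>Taking sections commutes with union and intersection, so the inequality for
  \<open>F\<close> holds at each point and is integrated. Monotonicity of \<open>F\<close> is not
  assumed, which allows \<open>F\<close> to be a difference \<open>\<phi>2 - \<mu>2\<close>.\<close>

lemma submodular_integral_sections:
  assumes sub: "\<And>S T. S \<in> B' \<Longrightarrow> T \<in> B' \<Longrightarrow> F (S \<inter> T) + F (S \<union> T) \<le> F S + F T"
    and X: "simple_sections J B B' X" and Y: "simple_sections J B B' Y"
  shows "simple_integral_on J \<phi> (\<lambda>x. F ((X \<inter> Y) `` {x})) +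
      simple_integral_on J \<phi> (\<lambda>x. F ((X \<union> Y) `` {x}))
    \<le> simple_integral_on J \<phi> (\<lambda>x. F (X `` {x})) + simple_integral_on J \<phi> (\<lambda>x. F (Y `` {x}))"
proof -
  have sX: "simple_map J B (\<lambda>x. X `` {x})" and sY: "simple_map J B (\<lambda>x. Y `` {x})"
    using X Y by (auto simp: simple_sections_def)
  have eq: "(X \<inter> Y) `` {x} = X `` {x} \<inter> Y `` {x}" "(X \<union> Y) `` {x} = X `` {x} \<union> Y `` {x}" for x
    by auto
  let ?I = "simple_integral_on J \<phi>"
  have s: "simple_map J B (\<lambda>x. h (X `` {x}) (Y `` {x}))" for h :: "'b set \<Rightarrow> 'b set \<Rightarrow> real"
    using sX sY by (rule simple_map_compose2)
  have "?I (\<lambda>x. F (X `` {x} \<inter> Y `` {x})) + ?I (\<lambda>x. F (X `` {x} \<union> Y `` {x})) =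
      ?I (\<lambda>x. F (X `` {x} \<inter> Y `` {x}) + F (X `` {x} \<union> Y `` {x}))"
    by (intro simple_integral_on_add[symmetric] s[of "\<lambda>S T. F (S \<inter> T)"] s[of "\<lambda>S T. F (S \<union> T)"])
  also have "\<dots> \<le> ?I (\<lambda>x. F (X `` {x}) + F (Y `` {x}))"
    using X Y by (intro simple_integral_on_mono sub s[of "\<lambda>S T. F (S \<inter> T) + F (S \<union> T)"]
        s[of "\<lambda>S T. F S + F T"]) (auto simp: simple_sections_def)
  also have "\<dots> = ?I (\<lambda>x. F (X `` {x})) + ?I (\<lambda>x. F (Y `` {x}))"
    by (intro simple_integral_on_add s[of "\<lambda>S T. F S"] s[of "\<lambda>S T. F T"])
  finally show ?thesis
    unfolding eq .
qed

lemma integral_sections_nonneg: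
  assumes "\<And>S. S \<in> B' \<Longrightarrow> 0 \<le> F S" and "simple_sections J B B' X"
  shows "0 \<le> simple_integral_on J \<phi> (\<lambda>x. F (X `` {x}))"
proof -
  have "simple_map J B (\<lambda>x. F (X `` {x}))"
    using assms(2) simple_map_compose[of "\<lambda>x. X `` {x}" F] by (simp add: simple_sections_def)
  then have "simple_integral_on J \<phi> (\<lambda>_. 0) \<le> simple_integral_on J \<phi> (\<lambda>x. F (X `` {x}))"
    using assms by (intro simple_integral_on_mono simple_map_const) (auto simp: simple_sections_def)
  then show ?thesis by (simp only: simple_integral_on_zero)
qed

lemma integral_sections_add:
  assumes "simple_sections J B B' X"
  shows "simple_integral_on J \<phi> (\<lambda>x. F (X `` {x}) + G (X `` {x})) =
    simple_integral_on J \<phi> (\<lambda>x. F (X `` {x})) + simple_integral_on J \<phi> (\<lambda>x. G (X `` {x}))"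
proof (rule simple_integral_on_add)
  have "simple_map J B (\<lambda>x. X `` {x})"
    using assms by (simp add: simple_sections_def)
  then show "simple_map J B (\<lambda>x. F (X `` {x}))" "simple_map J B (\<lambda>x. G (X `` {x}))"
    by (rule simple_map_compose)+
qed

lemma integral_sections_Times:
  assumes "X1 \<in> B" "F {} = 0"
  shows "simple_integral_on J \<phi> (\<lambda>x. F ((X1 \<times> X2) `` {x})) = F X2 * \<phi> X1"
proof -
  have "F ((X1 \<times> X2) `` {x}) = (if x \<in> X1 then F X2 else 0)" for x
    using assms(2) by (cases "x \<in> X1") (auto simp: Image_def)
  then show ?thesis
    using simple_integral_on_If[OF assms(1)] by simp
qed

text \<open>Serves for sets containing a cylinder, all of whose sections contain one fixed set; this
  bounds the competitors in the envelope from below.\<close>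

lemma integral_sections_ge_const:
  assumes "simple_sections J B B' X" "\<And>x. x \<in> J \<Longrightarrow> c \<le> F (X `` {x})"
  shows "c * \<phi> J \<le> simple_integral_on J \<phi> (\<lambda>x. F (X `` {x}))"
proof -
  have "simple_map J B (\<lambda>x. F (X `` {x}))"
    using assms(1) simple_map_compose[of "\<lambda>x. X `` {x}" F] by (simp add: simple_sections_def)
  then have "simple_integral_on J \<phi> (\<lambda>_. c) \<le> simple_integral_on J \<phi> (\<lambda>x. F (X `` {x}))"
    using assms(2) by (intro simple_integral_on_mono simple_map_const)
  then show ?thesis by (simp only: simple_integral_on_const)
qed

end

text \<open>Grouping points of \<open>J1\<close> by their section \<open>S\<close> cuts
  \<open>X\<close> into finitely many disjoint rectangles \<open>A S \<times> S\<close>. Both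
  iterated integrals equal the sum of \<open>\<mu>1 (A S) * \<mu>2 S\<close>.\<close>

lemma integral_sections_Fubini:
  assumes "additive_polymatroid J1 B1 \<mu>1" "additive_polymatroid J2 B2 \<mu>2"
    and X: "simple_sections J1 B1 B2 X" and XJ: "X \<subseteq> J1 \<times> J2"
  shows "simple_integral_on J1 \<mu>1 (\<lambda>x. \<mu>2 (X `` {x})) =
    simple_integral_on J2 \<mu>2 (\<lambda>y. \<mu>1 (X\<inverse> `` {y}))"
proof -
  interpret m1: additive_polymatroid J1 B1 \<mu>1 by fact
  interpret m2: additive_polymatroid J2 B2 \<mu>2 by fact
  define R where "R = (\<lambda>x. X `` {x}) ` J1"
  define A where "A S = {x \<in> J1. X `` {x} = S}" for S
  have fin: "finite R" and A: "A S \<in> B1" and R: "S \<in> R \<Longrightarrow> S \<in> B2" for S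
    using X by (auto simp: simple_sections_def simple_map_def R_def A_def)
  have *: "\<mu>1 (X\<inverse> `` {y}) = (\<Sum>S\<in>R. if y \<in> S then \<mu>1 (A S) else 0)" for y
  proof -
    have "X\<inverse> `` {y} = (\<Union>S\<in>{S \<in> R. y \<in> S}. A S)"
      using XJ by (auto simp: R_def A_def)
    then have "\<mu>1 (X\<inverse> `` {y}) = (\<Sum>S\<in>{S \<in> R. y \<in> S}. \<mu>1 (A S))"
      using fin A by (simp only:) (intro m1.finite_additive; auto simp: disjoint_family_on_def A_def)
    then show ?thesis
      using fin by (simp add: sum.inter_filter)
  qed
  have "simple_integral_on J1 \<mu>1 (\<lambda>x. \<mu>2 (X `` {x})) = (\<Sum>S\<in>R. \<mu>2 S * \<mu>1 (A S))"
    unfolding R_def A_def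
    using X by (intro m1.simple_integral_on_compose) (simp add: simple_sections_def)
  also have "\<dots> = (\<Sum>S\<in>R. simple_integral_on J2 \<mu>2 (\<lambda>y. if y \<in> S then \<mu>1 (A S) else 0))"
    by (intro sum.cong refl) (simp add: m2.simple_integral_on_If R)
  also have "\<dots> = simple_integral_on J2 \<mu>2 (\<lambda>y. \<mu>1 (X\<inverse> `` {y}))"
    unfolding * by (intro m2.simple_integral_on_sum[symmetric] m2.simple_map_If R)
  finally show ?thesis .
qed

section \<open>The coupling\<close>

text \<open>If \<open>S\<close> and \<open>T\<close> compete in the infima for \<open>X\<close> and
  \<open>Y\<close>, then \<open>S \<inter> T\<close> and \<open>S \<union> T\<close> compete in
  those for \<open>X \<inter> Y\<close> and \<open>X \<union> Y\<close>, so submodularity passes to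
  the envelope. Monotonicity holds because a larger set has fewer supersets.\<close>

lemma polymatroid_increasing_envelope:
  fixes \<psi> :: "'a set \<Rightarrow> real"
  assumes "algebra J B" and nonneg: "\<And>X. X \<in> B \<Longrightarrow> 0 \<le> \<psi> X" and "\<psi> {} = 0"
    and sub: "\<And>X Y. X \<in> B \<Longrightarrow> Y \<in> B \<Longrightarrow> \<psi> (X \<inter> Y) + \<psi> (X \<union> Y) \<le> \<psi> X + \<psi> Y"
  shows "polymatroid_function J B (\<lambda>X. INF Y\<in>{Y \<in> B. X \<subseteq> Y}. \<psi> Y)"
proof -
  interpret algebra J B by fact
  let ?\<phi> = "\<lambda>X. INF Y\<in>{Y \<in> B. X \<subseteq> Y}. \<psi> Y"
  have ne: "{Y \<in> B. X \<subseteq> Y} \<noteq> {}" if "X \<in> B" for X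
    using that by blast
  have bdd: "bdd_below (\<psi> ` {Y \<in> B. X \<subseteq> Y})" for X
    using nonneg by (auto intro: bdd_belowI2[where m = 0])
  have le: "?\<phi> X \<le> \<psi> Y" if "Y \<in> B" "X \<subseteq> Y" for X Y
    using that by (intro cINF_lower bdd) auto
  have ge: "0 \<le> ?\<phi> X" if "X \<in> B" for X
    using nonneg by (intro cINF_greatest[OF ne[OF that]]) auto
  show ?thesis
  proof unfold_locales
    fix X Y assume X: "X \<in> B" and Y: "Y \<in> B"
    { assume "X \<subseteq> Y"
      then show "?\<phi> X \<le> ?\<phi> Y"
        by (intro cINF_greatest[OF ne[OF Y]] le) auto }
    let ?L = "?\<phi> (X \<inter> Y) + ?\<phi> (X \<union> Y)"
    have *: "?L \<le> \<psi> S + \<psi> T" if "S \<in> B" "X \<subseteq> S" "T \<in> B" "Y \<subseteq> T" for S T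
      using le[of "S \<inter> T" "X \<inter> Y"] le[of "S \<union> T" "X \<union> Y"] sub[of S T] that by fastforce
    have "?L - \<psi> S \<le> ?\<phi> Y" if "S \<in> B" "X \<subseteq> S" for S
      using *[OF that] by (intro cINF_greatest[OF ne[OF Y]]) (simp add: algebra_simps)
    then have "?L - ?\<phi> Y \<le> ?\<phi> X"
      by (intro cINF_greatest[OF ne[OF X]]) (simp add: algebra_simps)
    then show "?L \<le> ?\<phi> X + ?\<phi> Y" by simp
  next
    show "?\<phi> {} = 0"
      using le[of "{}" "{}"] ge[of "{}"] \<open>\<psi> {} = 0\<close> by auto
  qed (rule ge)
qed

theorem theorem3p19:
  fixes J1 :: "'a set" and B1 :: "'a set set" and \<phi>1 :: "'a set \<Rightarrow> real"
    and J2 :: "'b set" and B2 :: "'b set set" and \<phi>2 :: "'b set \<Rightarrow> real"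
  assumes "polymatroid_function J1 B1 \<phi>1"
    and "polymatroid_function J2 B2 \<phi>2"
  shows "\<exists>\<phi>. polymatroid_function (J1 \<times> J2) (product_algebra J1 B1 J2 B2) \<phi> \<and>
             is_coupling J1 B1 \<phi>1 J2 B2 \<phi>2 \<phi>"
proof -
  interpret p1: polymatroid_function J1 B1 \<phi>1 by fact
  interpret p2: polymatroid_function J2 B2 \<phi>2 by fact
  obtain \<mu>1 where "additive_polymatroid J1 B1 \<mu>1" and tot1: "\<mu>1 J1 = \<phi>1 J1"
    and le1: "\<And>X. X \<in> B1 \<Longrightarrow> \<mu>1 X \<le> \<phi>1 X"
    using p1.additive_minorant by blast
  then interpret m1: additive_polymatroid J1 B1 \<mu>1 by simp
  obtain \<mu>2 where "additive_polymatroid J2 B2 \<mu>2" and tot2: "\<mu>2 J2 = \<phi>2 J2"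
    and le2: "\<And>X. X \<in> B2 \<Longrightarrow> \<mu>2 X \<le> \<phi>2 X"
    using p2.additive_minorant by blast
  then interpret m2: additive_polymatroid J2 B2 \<mu>2 by simp
  note alg = p1.algebra_axioms p2.algebra_axioms
  let ?P = "product_algebra J1 B1 J2 B2"
  interpret P: algebra "J1 \<times> J2" ?P
    using alg by (rule algebra_product_algebra)
  note sec1 = product_algebra_simple_sections(1)[OF alg]
  note sec2 = product_algebra_simple_sections(2)[OF alg]
  define I1 where "I1 F X = simple_integral_on J1 \<mu>1 (\<lambda>x. F (X `` {x}))"
    for F and X :: "('a \<times> 'b) set"
  define I2 where "I2 F X = simple_integral_on J2 \<mu>2 (\<lambda>y. F (X\<inverse> `` {y}))"
    for F and X :: "('a \<times> 'b) set"
  define d1 where "d1 S = \<phi>1 S - \<mu>1 S" for S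
  define d2 where "d2 S = \<phi>2 S - \<mu>2 S" for S
  \<comment> \<open>The product term is absorbed into \<open>d2\<close>, so both summands are
    nonnegative and submodular. This form suits cylinders over \<open>J1\<close>, as
    \<open>d2\<close> vanishes on \<open>J2\<close>.\<close>
  define \<psi> where "\<psi> X = I2 \<phi>1 X + I1 d2 X" for X
  \<comment> \<open>Fubini moves the product term to the other integral; this mirrored form yields
    the second marginal.\<close>
  have \<psi>': "\<psi> X = I1 \<phi>2 X + I2 d1 X" if "X \<in> ?P" for X
  proof -
    have "I1 \<phi>2 X = I1 d2 X + I1 \<mu>2 X"
      using m1.integral_sections_add[OF sec1[OF that], of d2 \<mu>2] by (simp add: I1_def d2_def)
    moreover have "I2 \<phi>1 X = I2 d1 X + I2 \<mu>1 X"
      using m2.integral_sections_add[OF sec2[OF that], of d1 \<mu>1] by (simp add: I2_def d1_def)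
    moreover have "I1 \<mu>2 X = I2 \<mu>1 X"
      unfolding I1_def I2_def
      using m1.additive_polymatroid_axioms m2.additive_polymatroid_axioms sec1[OF that]
        P.sets_into_space[OF that] by (rule integral_sections_Fubini)
    ultimately show ?thesis by (simp add: \<psi>_def)
  qed
  have d1: "0 \<le> I2 d1 X" and d2: "0 \<le> I1 d2 X" and \<phi>1: "0 \<le> I2 \<phi>1 X" if "X \<in> ?P" for X
    unfolding I1_def I2_def
    using that le1 le2 p1.nonneg
    by (auto simp: d1_def d2_def intro!: m1.integral_sections_nonneg[OF _ sec1]
        m2.integral_sections_nonneg[OF _ sec2])
  have sub: "\<psi> (X \<inter> Y) + \<psi> (X \<union> Y) \<le> \<psi> X + \<psi> Y" if "X \<in> ?P" "Y \<in> ?P" for X Y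
  proof -
    have "d2 (S \<inter> T) + d2 (S \<union> T) \<le> d2 S + d2 T" if "S \<in> B2" "T \<in> B2" for S T
      using p2.submodular[OF that] m2.modular[OF that] by (simp add: d2_def)
    then have "I1 d2 (X \<inter> Y) + I1 d2 (X \<union> Y) \<le> I1 d2 X + I1 d2 Y"
      unfolding I1_def by (rule m1.submodular_integral_sections[OF _ sec1 sec1]) (use that in auto)
    moreover have "I2 \<phi>1 (X \<inter> Y) + I2 \<phi>1 (X \<union> Y) \<le> I2 \<phi>1 X + I2 \<phi>1 Y"
      unfolding I2_def converse_Int converse_Un
      using that by (intro m2.submodular_integral_sections[OF _ sec2 sec2] p1.submodular)
    ultimately show ?thesis by (simp add: \<psi>_def)
  qed
  have "d1 {} = 0" "d2 {} = 0" "d1 J1 = 0" "d2 J2 = 0"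
    by (simp_all add: d1_def d2_def p1.empty p2.empty m1.empty m2.empty tot1 tot2)
  note d0 = this
  have row: "\<psi> (X1 \<times> J2) = \<phi>1 X1 * \<phi>2 J2" if "X1 \<in> B1" for X1
    using that d0 m1.integral_sections_Times[of X1 d2 J2] m2.integral_sections_Times[of J2 \<phi>1 X1]
    by (simp add: \<psi>_def I1_def I2_def converse_Times p1.empty tot2)
  have rowP: "X1 \<times> J2 \<in> ?P" if "X1 \<in> B1" for X1
    using that hull_subset[of _ "algebra (J1 \<times> J2)"] unfolding product_algebra_def by fast
  have colP: "J1 \<times> X2 \<in> ?P" if "X2 \<in> B2" for X2
    using that hull_subset[of _ "algebra (J1 \<times> J2)"] unfolding product_algebra_def by fast
  have col: "\<psi> (J1 \<times> X2) = \<phi>1 J1 * \<phi>2 X2" if "X2 \<in> B2" for X2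
    using that d0 m1.integral_sections_Times[of J1 \<phi>2 X2] m2.integral_sections_Times[of X2 d1 J1]
    by (simp add: \<psi>'[OF colP] I1_def I2_def converse_Times p2.empty tot1)
  have row_le: "\<phi>1 X1 * \<phi>2 J2 \<le> \<psi> Y" if X1: "X1 \<in> B1" and Y: "Y \<in> ?P" "X1 \<times> J2 \<subseteq> Y" for X1 Y
  proof -
    \<comment> \<open>Every horizontal section of \<open>Y\<close> over \<open>J2\<close> contains
      \<open>X1\<close>, because \<open>Y\<close> contains the cylinder.\<close>
    have "\<phi>1 X1 \<le> \<phi>1 (Y\<inverse> `` {y})" if "y \<in> J2" for y
      using sec2[OF Y(1)] that X1 Y(2) by (intro p1.increasing) (auto simp: simple_sections_def)
    then have "\<phi>1 X1 * \<phi>2 J2 \<le> I2 \<phi>1 Y"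
      using m2.integral_sections_ge_const[OF sec2[OF Y(1)], of "\<phi>1 X1" \<phi>1]
      by (simp add: I2_def tot2)
    then show ?thesis using d2[OF Y(1)] by (simp add: \<psi>_def)
  qed
  have col_le: "\<phi>1 J1 * \<phi>2 X2 \<le> \<psi> Y" if X2: "X2 \<in> B2" and Y: "Y \<in> ?P" "J1 \<times> X2 \<subseteq> Y" for X2 Y
  proof -
    have "\<phi>2 X2 \<le> \<phi>2 (Y `` {x})" if "x \<in> J1" for x
      using sec1[OF Y(1)] that X2 Y(2) by (intro p2.increasing) (auto simp: simple_sections_def)
    then have "\<phi>1 J1 * \<phi>2 X2 \<le> I1 \<phi>2 Y"
      using m1.integral_sections_ge_const[OF sec1[OF Y(1)], of "\<phi>2 X2" \<phi>2]
      by (simp add: I1_def tot1 mult.commute)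
    then show ?thesis using d1[OF Y(1)] by (simp add: \<psi>'[OF Y(1)])
  qed
  let ?\<phi> = "\<lambda>X. INF Y\<in>{Y \<in> ?P. X \<subseteq> Y}. \<psi> Y"
  have "\<psi> {} = 0"
    using row[of "{}"] by (simp add: p1.empty)
  then have "polymatroid_function (J1 \<times> J2) ?P ?\<phi>"
    using P.algebra_axioms sub d2 \<phi>1
    by (intro polymatroid_increasing_envelope) (auto simp: \<psi>_def)
  \<comment> \<open>The envelope leaves \<open>\<psi>\<close> unchanged wherever \<open>X\<close>
    itself is a cheapest superset, which \<open>row_le\<close> and \<open>col_le\<close> establish
    for the cylinders.\<close>
  moreover have "?\<phi> X = \<psi> X" if "X \<in> ?P" "\<And>Y. Y \<in> ?P \<Longrightarrow> X \<subseteq> Y \<Longrightarrow> \<psi> X \<le> \<psi> Y" for X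
    using that by (intro cInf_eq_minimum) auto
  then have "is_coupling J1 B1 \<phi>1 J2 B2 \<phi>2 ?\<phi>"
    unfolding is_coupling_def by (simp add: row col rowP colP row_le col_le)
  ultimately show ?thesis by blast
qed

end
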